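(* (1) Let $(X,r)$ be a left-non-degenerate (LND) involutive solution. A map $k\colon X\to X$ is a reflection for $(X,r)$ if and only if $$t(a,k(b))=t(a,b)\qquad\text{for all }a,b\in X,$$ where $t(a,b)=\lambda_{\lambda_a(b)}k\rho_b(a)$; explicitly, $\lambda_{\lambda_a(b)}k\rho_b(a)=\lambda_{\lambda_a(k(b))}k\rho_{k(b)}(a)$ for all $a,b\in X$. (2) Let $(X,r)$ be a right-non-degenerate (RND) involutive solution. A map $k\colon X\to X$ is a reflection for $(X,r)$ if and only if $$u(a,k(b))=k(u(a,b))\qquad\text{for all }a,b\in X,$$ where $u(a,b)=\rho_{k\rho_b(a)}\lambda_a(b)$; explicitly, $\rho_{k\rho_{k(b)}(a)}\lambda_a k(b)=k\rho_{k\rho_b(a)}\lambda_a(b)$ for all $a,b\in X$.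
   Context: Products of maps denote composition, the rightmost map being applied first. For a map $\phi\colon X^m\to X^m$, $\phi_i$ denotes the map on $X^n$ that applies $\phi$ to the $m$ consecutive coordinates starting at position $i$ and is the identity on the others. A solution $(X,r)$ is a set $X$ with a map $r\colon X\times X\to X\times X$ satisfying the Yang–Baxter equation $r_1r_2r_1=r_2r_1r_2$ on $X^3$; write $r(a,b)=(\lambda_a(b),\rho_b(a))$. It is left-non-degenerate (LND) if all maps $\lambda_a\colon X\to X$ are bijective, right-non-degenerate (RND) if all maps $\rho_b\colon X\to X$ are bijective, and involutive if $r^2=\mathrm{Id}$. A reflection for $(X,r)$ is a map $k\colon X\to X$ satisfying the reflection equation $r k_2 r k_2=k_2 r k_2 r$ on $X^2$. With the maps $t$ and $u$ of the claim, the reflection equation reads $(t(a,k(b)),u(a,k(b)))=(t(a,b),k(u(a,b)))$ for all $a,b\in X$, so the two conditions are its first and second coordinates respectively. Part (1) is credited to earlier work [SVW18]. *)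

theory Defs
  imports "HOL-Library.FuncSet"
begin

text \<open>The underlying set is a carrier \<open>X\<close> inside a type, possibly empty; maps are
  relevant only on \<open>X\<close>, \<open>X\<^sup>2 = X \<times> X\<close> and \<open>X\<^sup>3 = X \<times> X \<times> X\<close>.\<close>

definition on12 :: "('a \<times> 'a \<Rightarrow> 'a \<times> 'a) \<Rightarrow> 'a \<times> 'a \<times> 'a \<Rightarrow> 'a \<times> 'a \<times> 'a" where
  "on12 r = (\<lambda>(a, b, c). (fst (r (a, b)), snd (r (a, b)), c))"

definition on23 :: "('a \<times> 'a \<Rightarrow> 'a \<times> 'a) \<Rightarrow> 'a \<times> 'a \<times> 'a \<Rightarrow> 'a \<times> 'a \<times> 'a" where
  "on23 r = (\<lambda>(a, b, c). (a, fst (r (b, c)), snd (r (b, c))))"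

definition on2 :: "('a \<Rightarrow> 'a) \<Rightarrow> 'a \<times> 'a \<Rightarrow> 'a \<times> 'a" where
  "on2 k = (\<lambda>(a, b). (a, k b))"

definition yb_solution :: "'a set \<Rightarrow> ('a \<times> 'a \<Rightarrow> 'a \<times> 'a) \<Rightarrow> bool" where
  "yb_solution X r \<longleftrightarrow> r \<in> X \<times> X \<rightarrow> X \<times> X \<and>
     (\<forall>p \<in> X \<times> X \<times> X.
        (on12 r \<circ> on23 r \<circ> on12 r) p = (on23 r \<circ> on12 r \<circ> on23 r) p)"

text \<open>\<open>r (a, b) = (lam r a b, rho r b a)\<close>; the index is the first argument after \<open>r\<close>.\<close>

definition lam :: "('a \<times> 'a \<Rightarrow> 'a \<times> 'a) \<Rightarrow> 'a \<Rightarrow> 'a \<Rightarrow> 'a" where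
  "lam r a b = fst (r (a, b))"

definition rho :: "('a \<times> 'a \<Rightarrow> 'a \<times> 'a) \<Rightarrow> 'a \<Rightarrow> 'a \<Rightarrow> 'a" where
  "rho r b a = snd (r (a, b))"

definition left_nondegenerate :: "'a set \<Rightarrow> ('a \<times> 'a \<Rightarrow> 'a \<times> 'a) \<Rightarrow> bool" where
  "left_nondegenerate X r \<longleftrightarrow> (\<forall>a \<in> X. bij_betw (lam r a) X X)"

definition right_nondegenerate :: "'a set \<Rightarrow> ('a \<times> 'a \<Rightarrow> 'a \<times> 'a) \<Rightarrow> bool" where
  "right_nondegenerate X r \<longleftrightarrow> (\<forall>b \<in> X. bij_betw (rho r b) X X)"

definition involutive :: "'a set \<Rightarrow> ('a \<times> 'a \<Rightarrow> 'a \<times> 'a) \<Rightarrow> bool" where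
  "involutive X r \<longleftrightarrow> (\<forall>p \<in> X \<times> X. (r \<circ> r) p = p)"

definition reflection :: "'a set \<Rightarrow> ('a \<times> 'a \<Rightarrow> 'a \<times> 'a) \<Rightarrow> ('a \<Rightarrow> 'a) \<Rightarrow> bool" where
  "reflection X r k \<longleftrightarrow> k \<in> X \<rightarrow> X \<and>
     (\<forall>p \<in> X \<times> X.
        (r \<circ> on2 k \<circ> r \<circ> on2 k) p = (on2 k \<circ> r \<circ> on2 k \<circ> r) p)"

definition tmap :: "('a \<times> 'a \<Rightarrow> 'a \<times> 'a) \<Rightarrow> ('a \<Rightarrow> 'a) \<Rightarrow> 'a \<Rightarrow> 'a \<Rightarrow> 'a" where
  "tmap r k a b = lam r (lam r a b) (k (rho r b a))"

definition umap :: "('a \<times> 'a \<Rightarrow> 'a \<times> 'a) \<Rightarrow> ('a \<Rightarrow> 'a) \<Rightarrow> 'a \<Rightarrow> 'a \<Rightarrow> 'a" where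
  "umap r k a b = rho r (k (rho r b a)) (lam r a b)"

end

theory Submission
  imports Defs
begin

text \<open>Write \<open>k\<^sub>2 = on2 k\<close>, \<open>F = r k\<^sub>2 r k\<^sub>2\<close> and \<open>G = k\<^sub>2 r k\<^sub>2 r\<close>, so that \<open>k\<close> is a reflection
  iff \<open>F = G\<close> on \<open>X \<times> X\<close>. The two conditions of the theorem say that \<open>F\<close> and \<open>G\<close> agree in the
  first, respectively the second, coordinate; what has to be shown is that, under
  non-degeneracy on the matching side, agreement in one coordinate forces agreement in both.

  The idea is that involutivity makes \<open>r\<close> exchange the two sides of the reflection equation:
  \<open>r F = k\<^sub>2 r k\<^sub>2 = G r\<close> and \<open>r G = F r\<close>. Hence, if \<open>F\<close> and \<open>G\<close> agree in one coordinate at every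
  point, then using this at \<open>r p\<close> shows that \<open>r (F p)\<close> and \<open>r (G p)\<close> agree in that coordinate,
  while using it at \<open>p\<close> shows that \<open>F p\<close> and \<open>G p\<close> do. When all \<open>\<lambda>\<^sub>a\<close> are injective, a
  pair \<open>q\<close> is determined by the first coordinates of \<open>q\<close> and of \<open>r q\<close>; when all \<open>\<rho>\<^sub>b\<close> are
  injective, it is determined by the second ones. Hence \<open>F p = G p\<close>.\<close>

lemma left_nondegenerate_eqI:
  assumes "left_nondegenerate X r" "p \<in> X \<times> X" "q \<in> X \<times> X"
    and "fst p = fst q" "fst (r p) = fst (r q)"
  shows "p = q"
  using assms
  by (auto simp: left_nondegenerate_def lam_def bij_betw_def inj_on_def)

lemma right_nondegenerate_eqI:
  assumes "right_nondegenerate X r" "p \<in> X \<times> X" "q \<in> X \<times> X"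
    and "snd p = snd q" "snd (r p) = snd (r q)"
  shows "p = q"
  using assms
  by (auto simp: right_nondegenerate_def rho_def bij_betw_def inj_on_def)

lemma on2_in_square: "k \<in> X \<rightarrow> X \<Longrightarrow> p \<in> X \<times> X \<Longrightarrow> on2 k p \<in> X \<times> X"
  by (auto simp: on2_def)

definition reflection_lhs :: "('a \<times> 'a \<Rightarrow> 'a \<times> 'a) \<Rightarrow> ('a \<Rightarrow> 'a) \<Rightarrow> 'a \<times> 'a \<Rightarrow> 'a \<times> 'a" where
  "reflection_lhs r k = r \<circ> on2 k \<circ> r \<circ> on2 k"

definition reflection_rhs :: "('a \<times> 'a \<Rightarrow> 'a \<times> 'a) \<Rightarrow> ('a \<Rightarrow> 'a) \<Rightarrow> 'a \<times> 'a \<Rightarrow> 'a \<times> 'a" where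
  "reflection_rhs r k = on2 k \<circ> r \<circ> on2 k \<circ> r"

lemma reflection_lhs_pair: "reflection_lhs r k (a, b) = (tmap r k a (k b), umap r k a (k b))"
  by (simp add: reflection_lhs_def tmap_def umap_def lam_def rho_def on2_def split_beta)

lemma reflection_rhs_pair: "reflection_rhs r k (a, b) = (tmap r k a b, k (umap r k a b))"
  by (simp add: reflection_rhs_def tmap_def umap_def lam_def rho_def on2_def split_beta)

lemma reflection_iff_sides_eq:
  assumes "k \<in> X \<rightarrow> X"
  shows "reflection X r k \<longleftrightarrow> (\<forall>p \<in> X \<times> X. reflection_lhs r k p = reflection_rhs r k p)"
  using assms by (simp add: reflection_def reflection_lhs_def reflection_rhs_def)

context
  fixes X :: "'a set" and r :: "'a \<times> 'a \<Rightarrow> 'a \<times> 'a" and k :: "'a \<Rightarrow> 'a"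
  assumes r_in: "r \<in> X \<times> X \<rightarrow> X \<times> X" and inv: "involutive X r" and k_in: "k \<in> X \<rightarrow> X"
begin

lemma r_r: "p \<in> X \<times> X \<Longrightarrow> r (r p) = p"
  using inv unfolding involutive_def o_apply by blast

lemma r_in_square: "p \<in> X \<times> X \<Longrightarrow> r p \<in> X \<times> X"
  using r_in by blast

lemma reflection_sides_in_square:
  assumes "p \<in> X \<times> X"
  shows "reflection_lhs r k p \<in> X \<times> X" "reflection_rhs r k p \<in> X \<times> X"
  unfolding reflection_lhs_def reflection_rhs_def o_apply
  by (intro r_in_square on2_in_square k_in assms)+

text \<open>Each side is a word alternating between \<open>r\<close> and \<open>on2 k\<close>; when \<open>r\<close> meets an \<open>r\<close> at
  one end of the word, the two cancel.\<close>

lemma r_exchanges_reflection_sides: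
  assumes "p \<in> X \<times> X"
  shows "reflection_rhs r k (r p) = r (reflection_lhs r k p)"
    and "reflection_lhs r k (r p) = r (reflection_rhs r k p)"
  using assms
  by (simp_all only: reflection_lhs_def reflection_rhs_def o_apply r_r r_in_square
      on2_in_square[OF k_in])

text \<open>Left and right are treated at once by letting \<open>c\<close> stand for either coordinate projection.\<close>

lemma reflection_iff_coordinate_eq:
  fixes c :: "'a \<times> 'a \<Rightarrow> 'a"
  assumes determined: "\<And>p q. p \<in> X \<times> X \<Longrightarrow> q \<in> X \<times> X \<Longrightarrow> c p = c q \<Longrightarrow> c (r p) = c (r q) \<Longrightarrow> p = q"
  shows "reflection X r k \<longleftrightarrow>
    (\<forall>p \<in> X \<times> X. c (reflection_lhs r k p) = c (reflection_rhs r k p))" (is "_ \<longleftrightarrow> ?R")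
proof
  assume "reflection X r k"
  then show ?R
    by (simp add: reflection_iff_sides_eq[OF k_in])
next
  assume R: ?R
  have "reflection_lhs r k p = reflection_rhs r k p" if p: "p \<in> X \<times> X" for p
  proof (rule determined)
    show "c (reflection_lhs r k p) = c (reflection_rhs r k p)"
      by (rule bspec[OF R p])
    have "c (reflection_lhs r k (r p)) = c (reflection_rhs r k (r p))"
      by (rule bspec[OF R r_in_square[OF p]])
    then show "c (r (reflection_lhs r k p)) = c (r (reflection_rhs r k p))"
      by (simp only: r_exchanges_reflection_sides[OF p])
  qed (rule reflection_sides_in_square[OF p])+
  then show "reflection X r k"
    by (simp add: reflection_iff_sides_eq[OF k_in])
qed

end

theorem theorem3p1:
  fixes X :: "'a set" and r :: "'a \<times> 'a \<Rightarrow> 'a \<times> 'a" and k :: "'a \<Rightarrow> 'a"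
  shows "(yb_solution X r \<and> left_nondegenerate X r \<and> involutive X r \<and> k \<in> X \<rightarrow> X \<longrightarrow>
            (reflection X r k \<longleftrightarrow> (\<forall>a \<in> X. \<forall>b \<in> X. tmap r k a (k b) = tmap r k a b))) \<and>
         (yb_solution X r \<and> right_nondegenerate X r \<and> involutive X r \<and> k \<in> X \<rightarrow> X \<longrightarrow>
            (reflection X r k \<longleftrightarrow> (\<forall>a \<in> X. \<forall>b \<in> X. umap r k a (k b) = k (umap r k a b))))"
proof (intro conjI impI; elim conjE)
  assume yb: "yb_solution X r" and lnd: "left_nondegenerate X r"
    and inv: "involutive X r" and k: "k \<in> X \<rightarrow> X"
  from yb have r: "r \<in> X \<times> X \<rightarrow> X \<times> X"
    by (simp add: yb_solution_def)
  have "reflection X r k \<longleftrightarrow>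
      (\<forall>p \<in> X \<times> X. fst (reflection_lhs r k p) = fst (reflection_rhs r k p))"
    by (rule reflection_iff_coordinate_eq[OF r inv k]) (rule left_nondegenerate_eqI[OF lnd])
  then show "reflection X r k \<longleftrightarrow> (\<forall>a \<in> X. \<forall>b \<in> X. tmap r k a (k b) = tmap r k a b)"
    by (simp add: reflection_lhs_pair reflection_rhs_pair)
next
  assume yb: "yb_solution X r" and rnd: "right_nondegenerate X r"
    and inv: "involutive X r" and k: "k \<in> X \<rightarrow> X"
  from yb have r: "r \<in> X \<times> X \<rightarrow> X \<times> X"
    by (simp add: yb_solution_def)
  have "reflection X r k \<longleftrightarrow>
      (\<forall>p \<in> X \<times> X. snd (reflection_lhs r k p) = snd (reflection_rhs r k p))"
    by (rule reflection_iff_coordinate_eq[OF r inv k]) (rule right_nondegenerate_eqI[OF rnd])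
  then show "reflection X r k \<longleftrightarrow> (\<forall>a \<in> X. \<forall>b \<in> X. umap r k a (k b) = k (umap r k a b))"
    by (simp add: reflection_lhs_pair reflection_rhs_pair)
qed

end
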